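(* For every $\varepsilon > 0$ there exists a discrete probability measure $\mu$ supported on $(0,1)$ such that $$\mathbb{P}_{\mu^{\otimes 4}}\left[X_1 + X_2 + X_3 < 2 X_4\right] \;\ge\; \sup_{p \in (0,1)} \frac{p(2-p)}{1 + p + p^2 + p^3} \;-\; \varepsilon,$$ where $X_1, X_2, X_3, X_4$ are independent random variables with distribution $\mu$.
   Context: $\mu^{\otimes 4}$ denotes the 4-fold product measure, and $X_1,\dots,X_4$ are the coordinate variables. A discrete probability measure is one concentrated on a countable set of atoms. *)

theory Defs
  imports "HOL-Probability.Probability"
begin

definition discrete_prob :: "real measure \<Rightarrow> bool" where
  "discrete_prob \<mu> \<longleftrightarrow>
     prob_space \<mu> \<and> sets \<mu> = sets borel \<and>
     (\<exists>A. countable A \<and> (\<forall>a\<in>A. measure \<mu> {a} > 0) \<and> measure \<mu> A = 1)"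

end

(* The measure lives on levels k = 0, 1, 2, ... of size d^k with d tiny, and level k has mass
   (1 - p) p^k. Inside a level there are n equally likely atoms d^k (1 - 1/4^(j+1)), j < n, whose
   deficits shrink fast. Put X_4 in level k. Then the event holds whenever X_1, X_2, X_3 lie in
   levels >= k, not all in level k, except when exactly two of them lie in level k and both have
   index >= j, where j is the index of X_4. For large n the exception removes one third of the
   case with two coordinates in level k, so summing over k gives
   (1 - p) (1 - (1-p)^3 - (1-p)^2 p) / (1 - p^4) = p (2 - p) / (1 + p + p^2 + p^3). *)
theory Submission
  imports Defs "HOL-Real_Asymp.Real_Asymp"
begin

section \<open>Atoms on levels and the pointwise comparison\<close>

definition atom :: "nat \<Rightarrow> nat \<times> nat \<Rightarrow> real" where
  "atom n = (\<lambda>(k, j). (1 / 4 ^ (n + 1)) ^ k * (1 - 1 / 4 ^ (j + 1)))"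

definition tail_levels :: "nat \<Rightarrow> (nat \<times> nat) set" where
  "tail_levels k = {k..} \<times> UNIV"

definition level :: "nat \<Rightarrow> (nat \<times> nat) set" where
  "level k = {k} \<times> UNIV"

definition top_of_level :: "nat \<Rightarrow> nat \<Rightarrow> (nat \<times> nat) set" where
  "top_of_level k j = {k} \<times> {j..}"

lemma atom_bounds: "0 < atom n x" "atom n x < 1"
proof -
  obtain k j where x: "x = (k, j)" by (cases x)
  have "(1::real) / 4 ^ (j + 1) < 1" "(1::real) / 4 ^ (j + 1) > 0"
    using one_less_power[of "4::real" "j + 1"] by simp_all
  moreover have "(1 / 4 ^ (n + 1)) ^ k \<le> (1::real)" "(1 / 4 ^ (n + 1)) ^ k > (0::real)"
    using one_le_power[of "4::real" "n + 1"] by (auto intro!: power_le_one simp del: power_Suc)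
  ultimately show "0 < atom n x" "atom n x < 1"
    unfolding atom_def x by (auto intro: mult_pos_pos le_less_trans[OF mult_right_mono, of _ 1])
qed

text \<open>A point of \<open>tail_levels k\<close> outside \<open>top_of_level k j\<close> either
  has a smaller index in level \<open>k\<close>, so its deficit is at least four times that of
  \<open>(k, j)\<close>, or sits in a later level and is negligible. Either loss is more than the
  gap of \<open>2 * atom n (k, j)\<close> below twice the level size can absorb.\<close>

lemma atom_sum_less_aux:
  assumes "j < n" "x \<in> tail_levels k" "y \<in> tail_levels k" "z \<in> tail_levels (Suc k)"
    and "x \<notin> top_of_level k j"
  shows "atom n x + atom n y + atom n z < 2 * atom n (k, j)"
proof -
  define d :: real where "d = 1 / 4 ^ (n + 1)"
  define a where "a = d ^ k"
  define e :: real where "e = 1 / 4 ^ (j + 1)"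
  have d: "0 < d" "d \<le> 1"
    using one_le_power[of "4::real" "n + 1"] by (auto simp: d_def simp del: power_Suc)
  have a: "a > 0" using d by (simp add: a_def)
  have e: "0 < e" "e \<le> 1 / 4"
    using one_le_power[of "4::real" j] by (auto simp: e_def field_simps)
  \<comment> \<open>The ratio \<open>d\<close> is a quarter of the smallest deficit
    \<open>1 / 4 ^ n\<close> among the indices below \<open>n\<close>, so a point of a later level
    cannot make up for a deficit in level \<open>k\<close>.\<close>
  have "(4::real) ^ (j + 2) \<le> 4 ^ (n + 1)"
    using \<open>j < n\<close> by (intro power_increasing) auto
  hence de: "d \<le> e / 4" by (simp add: d_def e_def field_simps)
  have atom_eq: "atom n (k', j') = d ^ k' * (1 - 1 / 4 ^ (j' + 1))" for k' j'
    by (simp add: atom_def d_def)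
  have low: "atom n u < a * d" if "u \<in> tail_levels (Suc k)" for u
  proof -
    obtain k' j' where u: "u = (k', j')" by (cases u)
    have "Suc k \<le> k'" using that by (simp add: u tail_levels_def)
    hence "d ^ k' \<le> d ^ Suc k" using d by (intro power_decreasing) auto
    moreover have "d ^ k' * (1 - 1 / 4 ^ (j' + 1)) < d ^ k' * 1"
      using d by (intro mult_strict_left_mono) auto
    ultimately show ?thesis by (simp add: u atom_eq a_def mult.commute)
  qed
  have level: "atom n u < a" if "u \<in> tail_levels k" for u
  proof -
    obtain k' j' where u: "u = (k', j')" by (cases u)
    have "k \<le> k'" using that by (simp add: u tail_levels_def)
    hence "d ^ k' \<le> a" using d unfolding a_def by (intro power_decreasing) auto
    moreover have "d ^ k' * (1 - 1 / 4 ^ (j' + 1)) < d ^ k' * 1"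
      using d by (intro mult_strict_left_mono) auto
    ultimately show ?thesis by (simp add: u atom_eq)
  qed
  have w: "atom n (k, j) = a - a * e"
    by (simp add: atom_eq e_def a_def algebra_simps)
  have ade: "a * d \<le> a * e / 4" using mult_left_mono[OF de, of a] a by simp
  have ae: "0 < a * e" "a * e \<le> a / 4" using a e mult_left_mono[OF e(2), of a] by simp_all
  obtain k' j' where x: "x = (k', j')" by (cases x)
  show ?thesis
  proof (cases "k' = k")
    case True
    hence "j' < j" using assms by (auto simp: x top_of_level_def)
    hence "(4::real) ^ (j' + 2) \<le> 4 ^ (j + 1)"
      by (intro power_increasing) auto
    hence "4 * e \<le> 1 / 4 ^ (j' + 1)" by (simp add: e_def field_simps)
    hence "atom n x \<le> a * (1 - 4 * e)"
      using a by (simp add: x True atom_eq a_def)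
    hence "atom n x \<le> a - 4 * (a * e)" by (simp add: algebra_simps)
    \<comment> \<open>The left side is below \<open>2 * a - 4 * (a * e) + a * e / 4\<close>; the
      right side is \<open>2 * a - 2 * (a * e)\<close>.\<close>
    thus ?thesis using level[OF assms(3)] low[OF assms(4)] w ade ae by linarith
  next
    case False
    hence "x \<in> tail_levels (Suc k)" using assms by (auto simp: x tail_levels_def)
    \<comment> \<open>Now only \<open>y\<close> can be of size \<open>a\<close>: the left side is
      below \<open>a + a * e / 2\<close>, and \<open>a * e \<le> a / 4\<close> gives ample
      room.\<close>
    thus ?thesis using level[OF assms(3)] low[OF assms(4)] low[of x] w ade ae by linarith
  qed
qed

lemma atom_sum_less:
  assumes "j < n" "x \<in> tail_levels k" "y \<in> tail_levels k" "z \<in> tail_levels (Suc k)"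
    and "\<not> (x \<in> top_of_level k j \<and> y \<in> top_of_level k j)"
  shows "atom n x + atom n y + atom n z < 2 * atom n (k, j)"
  using atom_sum_less_aux[of j n x k y z] atom_sum_less_aux[of j n y k x z] assms by fastforce

text \<open>Pointwise this is the indicator of the favourable configurations when the fourth point is
  \<open>(k, j)\<close>. It is written as a sum of products so that it integrates factor by factor.\<close>

abbreviation win_weight :: "nat \<Rightarrow> nat \<Rightarrow> nat \<times> nat \<Rightarrow> nat \<times> nat \<Rightarrow> nat \<times> nat \<Rightarrow> real" where
  "win_weight k j x y z \<equiv>
     (let c = indicator (tail_levels k); l = indicator (tail_levels (Suc k));
          a = indicator (level k); g = indicator (top_of_level k j)
      in c x * c y * c z - a x * a y * a z
         - g x * g y * l z - g x * l y * g z - l x * g y * g z)"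

text \<open>If the weight is positive, all three points lie in the tail but not all in level
  \<open>k\<close>. Some point is then in \<open>tail_levels (Suc k)\<close> while the other two are
  not both in the top, which is \<open>atom_sum_less\<close> up to a permutation.\<close>

lemma win_weight_le:
  assumes "j < n"
  shows "win_weight k j x y z \<le> of_bool (atom n x + atom n y + atom n z < 2 * atom n (k, j))"
proof (cases "x \<in> tail_levels k \<and> y \<in> tail_levels k \<and> z \<in> tail_levels k")
  case False
  \<comment> \<open>The leading product vanishes and the remaining ones are subtracted, so the
    weight is at most 0.\<close>
  hence "indicator (tail_levels k) x * indicator (tail_levels k) y * indicator (tail_levels k) z = (0::real)"
    by (auto simp: indicator_def)
  moreover have "indicator A u * indicator B v * indicator C w \<ge> (0::real)" for A B C u v w
    by (simp add: indicator_def)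
  ultimately show ?thesis unfolding Let_def by (smt (verit) of_bool_def)
next
  case True
  have lev: "u \<in> level k \<longleftrightarrow> u \<notin> tail_levels (Suc k)" if "u \<in> tail_levels k" for u
    using that by (auto simp: level_def tail_levels_def)
  have top: "u \<notin> tail_levels (Suc k)" if "u \<in> top_of_level k j" for u
    using that by (auto simp: top_of_level_def tail_levels_def)
  define W where "W \<longleftrightarrow> atom n x + atom n y + atom n z < 2 * atom n (k, j)"
  have W: "z \<in> tail_levels (Suc k) \<Longrightarrow> \<not> (x \<in> top_of_level k j \<and> y \<in> top_of_level k j) \<Longrightarrow> W"
    "y \<in> tail_levels (Suc k) \<Longrightarrow> \<not> (x \<in> top_of_level k j \<and> z \<in> top_of_level k j) \<Longrightarrow> W"
    "x \<in> tail_levels (Suc k) \<Longrightarrow> \<not> (y \<in> top_of_level k j \<and> z \<in> top_of_level k j) \<Longrightarrow> W"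
    using True atom_sum_less[OF assms, of x k y z] atom_sum_less[OF assms, of x k z y]
      atom_sum_less[OF assms, of y k z x] unfolding W_def by (auto simp: ac_simps)
  show ?thesis
    unfolding W_def [symmetric]
    using True lev[of x] lev[of y] lev[of z] top[of x] top[of y] top[of z] W
    by (cases W) (auto simp: indicator_def Let_def)
qed

section \<open>Integrals over four-fold products, and products of pushforwards\<close>

lemma
  fixes M :: "'a measure" and a b c d :: "'a \<Rightarrow> real"
  assumes "prob_space M" "integrable M a" "integrable M b" "integrable M c" "integrable M d"
  shows integrable_PiM_4:
      "integrable (\<Pi>\<^sub>M i\<in>{1..4::nat}. M) (\<lambda>x. a (x 1) * b (x 2) * c (x 3) * d (x 4))"
    and integral_PiM_4:
      "(\<integral>x. a (x 1) * b (x 2) * c (x 3) * d (x 4) \<partial>(\<Pi>\<^sub>M i\<in>{1..4::nat}. M)) =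
         (\<integral>x. a x \<partial>M) * (\<integral>x. b x \<partial>M) * (\<integral>x. c x \<partial>M) * (\<integral>x. d x \<partial>M)"
proof -
  interpret prob_space M by fact
  interpret product_sigma_finite "\<lambda>_::nat. M" by unfold_locales
  \<comment> \<open>The product formula concerns an indexed family; on \<open>{1..4}\<close> the
    final branch is reached only for index 4.\<close>
  define f where "f i = (if i = 1 then a else if i = 2 then b else if i = 3 then c else d)" for i :: nat
  have 4: "{1..4::nat} = {1, 2, 3, 4}" by auto
  have int: "integrable M (f i)" for i using assms by (simp add: f_def)
  have prod: "(\<Prod>i\<in>{1..4}. f i (x i)) = a (x 1) * b (x 2) * c (x 3) * d (x 4)" for x
    unfolding 4 f_def by (simp add: mult.assoc)
  have iprod: "(\<Prod>i\<in>{1..4}. integral\<^sup>L M (f i)) =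
      (\<integral>x. a x \<partial>M) * (\<integral>x. b x \<partial>M) * (\<integral>x. c x \<partial>M) * (\<integral>x. d x \<partial>M)"
    unfolding 4 f_def by (simp add: mult.assoc)
  show "integrable (\<Pi>\<^sub>M i\<in>{1..4::nat}. M) (\<lambda>x. a (x 1) * b (x 2) * c (x 3) * d (x 4))"
    using product_integrable_prod[of "{1..4}" f] int prod by simp
  show "(\<integral>x. a (x 1) * b (x 2) * c (x 3) * d (x 4) \<partial>(\<Pi>\<^sub>M i\<in>{1..4::nat}. M)) =
         (\<integral>x. a x \<partial>M) * (\<integral>x. b x \<partial>M) * (\<integral>x. c x \<partial>M) * (\<integral>x. d x \<partial>M)"
    using product_integral_prod[of "{1..4}" f] int prod iprod by simp
qed

text \<open>A product of pushforwards is the coordinatewise pushforward of the product. This moves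
  the event from real coordinates to pairs of level and index, where the probabilities are
  computed.\<close>

lemma prob_PiM_distr:
  fixes q :: "'a pmf" and f :: "'a \<Rightarrow> real" and P :: "(nat \<Rightarrow> real) \<Rightarrow> bool"
  assumes "finite I"
    and "Measurable.pred (\<Pi>\<^sub>M i\<in>I. borel) P"
  shows "\<P>(x in (\<Pi>\<^sub>M i\<in>I. distr (measure_pmf q) borel f). P x) =
         \<P>(y in (\<Pi>\<^sub>M i\<in>I. measure_pmf q). P (compose I f y))"
proof -
  define \<mu> where "\<mu> = distr (measure_pmf q) borel f"
  have sets: "sets \<mu> = sets borel" by (simp add: \<mu>_def)
  interpret \<mu>: prob_space \<mu> unfolding \<mu>_def by (intro measure_pmf.prob_space_distr) simp
  \<comment> \<open>The pushforward rule for finite products wants a probability space as target,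
    which \<open>borel\<close> is not. Since \<open>\<mu>\<close> has the same measurable sets, it
    can be its own target.\<close>
  have "\<mu> = distr (measure_pmf q) \<mu> f"
    unfolding \<mu>_def by (intro distr_cong) auto
  hence "(\<Pi>\<^sub>M i\<in>I. \<mu>) = (\<Pi>\<^sub>M i\<in>I. distr (measure_pmf q) \<mu> f)" by simp
  also have "\<dots> = distr (\<Pi>\<^sub>M i\<in>I. measure_pmf q) (\<Pi>\<^sub>M i\<in>I. \<mu>) (compose I f)"
    by (intro distr_PiM_finite_prob_space' [symmetric] assms(1) \<mu>.prob_space_axioms
          measure_pmf.prob_space_axioms) (auto simp: measurable_def sets_eq_imp_space_eq[OF sets])
  finally have eq: "(\<Pi>\<^sub>M i\<in>I. \<mu>) =
      distr (\<Pi>\<^sub>M i\<in>I. measure_pmf q) (\<Pi>\<^sub>M i\<in>I. \<mu>) (compose I f)" .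
  have s: "sets (\<Pi>\<^sub>M i\<in>I. \<mu>) = sets (\<Pi>\<^sub>M i\<in>I. borel)"
    by (intro sets_PiM_cong) (auto simp: sets)
  have P: "{x \<in> space (\<Pi>\<^sub>M i\<in>I. \<mu>). P x} \<in> sets (\<Pi>\<^sub>M i\<in>I. \<mu>)"
    using assms(2) unfolding s sets_eq_imp_space_eq[OF s] by measurable
  have c: "compose I f \<in> measurable (\<Pi>\<^sub>M i\<in>I. measure_pmf q) (\<Pi>\<^sub>M i\<in>I. \<mu>)"
    unfolding compose_def
    by (intro measurable_restrict measurable_compose[OF measurable_component_singleton])
       (auto simp: measurable_def sets_eq_imp_space_eq[OF sets])
  have "\<P>(x in (\<Pi>\<^sub>M i\<in>I. \<mu>). P x) =
        \<P>(x in distr (\<Pi>\<^sub>M i\<in>I. measure_pmf q) (\<Pi>\<^sub>M i\<in>I. \<mu>) (compose I f). P x)"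
    using eq by simp
  also have "\<dots> = \<P>(y in (\<Pi>\<^sub>M i\<in>I. measure_pmf q). P (compose I f y))"
    using P c measurable_space[OF c]
    by (simp add: measure_distr) (auto intro!: arg_cong[where f = "measure _"])
  finally show ?thesis unfolding \<mu>_def .
qed

section \<open>The law of the pair of level and index, and the bound it yields\<close>

definition atom_law :: "real \<Rightarrow> nat \<Rightarrow> (nat \<times> nat) pmf" where
  "atom_law p n = pair_pmf (geometric_pmf (1 - p)) (pmf_of_set {..<n})"

lemma prob_geometric_atLeast:
  assumes "0 < p" "p < 1"
  shows "measure_pmf.prob (geometric_pmf (1 - p)) {k..} = p ^ k"
proof -
  have "measure_pmf.prob (geometric_pmf (1 - p)) {..<k} = (\<Sum>i<k. p ^ i * (1 - p))"
    using assms by (simp add: measure_measure_pmf_finite)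
  also have "\<dots> = 1 - p ^ k"
    unfolding sum_distrib_right [symmetric] using assms by (simp add: geometric_sum field_simps)
  finally have "measure_pmf.prob (geometric_pmf (1 - p)) {..<k} = 1 - p ^ k" .
  moreover have "{k..} = UNIV - {..<k}" by auto
  ultimately show ?thesis
    using measure_pmf.prob_compl[of "{..<k}" "geometric_pmf (1 - p)"] by simp
qed

lemma
  assumes "0 < p" "p < 1" "j < n"
  shows prob_tail_levels: "measure_pmf.prob (atom_law p n) (tail_levels k) = p ^ k"
    and prob_level: "measure_pmf.prob (atom_law p n) (level k) = (1 - p) * p ^ k"
    and prob_top_of_level:
      "measure_pmf.prob (atom_law p n) (top_of_level k j) = (1 - p) * p ^ k * (real (n - j) / n)"
    and prob_atom: "measure_pmf.prob (atom_law p n) {(k, j)} = (1 - p) * p ^ k / n"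
proof -
  have n: "{..<n} \<noteq> {}" using assms by auto
  have "{..<n} \<inter> {j..} = {j..<n}" by auto
  hence U: "measure_pmf.prob (pmf_of_set {..<n}) {j..} = real (n - j) / n"
    using n by (simp add: measure_pmf_of_set)
  have g: "measure_pmf.prob (geometric_pmf (1 - p)) {k} = (1 - p) * p ^ k"
    using assms by (simp add: measure_pmf_single)
  show "measure_pmf.prob (atom_law p n) (tail_levels k) = p ^ k"
    using assms prob_geometric_atLeast[of p k]
    by (simp add: atom_law_def tail_levels_def measure_pmf_prob_product)
  show "measure_pmf.prob (atom_law p n) (level k) = (1 - p) * p ^ k"
    using g by (simp add: atom_law_def level_def measure_pmf_prob_product)
  show "measure_pmf.prob (atom_law p n) (top_of_level k j) = (1 - p) * p ^ k * (real (n - j) / n)"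
    unfolding atom_law_def top_of_level_def
    by (subst measure_pmf_prob_product) (simp_all add: g U)
  show "measure_pmf.prob (atom_law p n) {(k, j)} = (1 - p) * p ^ k / n"
    using assms n by (simp add: atom_law_def measure_pmf_single pmf_pair)
qed

text \<open>Each summand is the expectation of \<open>win_weight k j\<close> over three independent
  points, times the mass of \<open>(k, j)\<close>. Cutting the levels off at the same
  \<open>n\<close> keeps the sum finite and leaves a single parameter to send to infinity.\<close>

definition win_bound :: "real \<Rightarrow> nat \<Rightarrow> real" where
  "win_bound p n = (\<Sum>k<n. \<Sum>j<n. ((p ^ k) ^ 3 - ((1 - p) * p ^ k) ^ 3
      - 3 * ((1 - p) * p ^ k * (real (n - j) / n))\<^sup>2 * p ^ Suc k) * ((1 - p) * p ^ k / n))"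

text \<open>The functions \<open>h k j\<close> have disjoint supports because \<open>y 4\<close> is
  a single pair, so their sum stays below the indicator of the event. Integrating it gives the
  bound, by independence of the coordinates.\<close>

lemma win_bound_le_prob:
  assumes "0 < p" "p < 1"
  shows "win_bound p n \<le> \<P>(y in (\<Pi>\<^sub>M i\<in>{1..4::nat}. measure_pmf (atom_law p n)).
           atom n (y 1) + atom n (y 2) + atom n (y 3) < 2 * atom n (y 4))"
proof -
  let ?Q = "measure_pmf (atom_law p n)"
  let ?P = "\<Pi>\<^sub>M i\<in>{1..4::nat}. ?Q"
  define E where "E = {y \<in> space ?P. atom n (y 1) + atom n (y 2) + atom n (y 3) < 2 * atom n (y 4)}"
  define h where "h k j y = win_weight k j (y 1) (y 2) (y 3) * indicator {(k, j)} (y 4)"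
    for k j and y :: "nat \<Rightarrow> nat \<times> nat"
  interpret P: prob_space ?P by (intro prob_space_PiM measure_pmf.prob_space_axioms)
  have comp: "(\<lambda>y. atom n (y i)) \<in> borel_measurable ?P" if "i \<in> {1..4}" for i
    using that by (intro measurable_compose[OF measurable_component_singleton]) auto
  have [measurable]: "E \<in> sets ?P"
    unfolding E_def using comp[of 1] comp[of 2] comp[of 3] comp[of 4] by simp
  have i4: "integrable ?P (\<lambda>y. indicator A (y 1) * indicator B (y 2) * indicator C (y 3) * (indicator D (y 4) :: real))"
    for A B C D
    by (rule integrable_PiM_4[OF measure_pmf.prob_space_axioms]) (auto intro!: measure_pmf.integrable_const_bound[of _ 1])
  have I4: "(\<integral>y. indicator A (y 1) * indicator B (y 2) * indicator C (y 3) * indicator D (y 4) \<partial>?P) =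
      measure ?Q A * measure ?Q B * measure ?Q C * measure ?Q D" for A B C D
    by (subst integral_PiM_4[OF measure_pmf.prob_space_axioms]) (auto intro!: measure_pmf.integrable_const_bound[of _ 1])
  have h: "integrable ?P (h k j)" for k j
    unfolding h_def Let_def left_diff_distrib by (intro Bochner_Integration.integrable_diff i4)
  have H: "(\<integral>y. h k j y \<partial>?P) = ((p ^ k) ^ 3 - ((1 - p) * p ^ k) ^ 3
      - 3 * ((1 - p) * p ^ k * (real (n - j) / n))\<^sup>2 * p ^ Suc k) * ((1 - p) * p ^ k / n)"
    if "j < n" for k j
    \<comment> \<open>Five four-fold products remain, each factoring over the coordinates. The three
      mixed ones have equal integrals, whence the factor 3.\<close>
    unfolding h_def Let_def left_diff_distrib
    by (simp only: Bochner_Integration.integral_diff i4 Bochner_Integration.integrable_diff I4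
          prob_tail_levels[OF assms that] prob_level[OF assms that]
          prob_top_of_level[OF assms that] prob_atom[OF assms that])
       (simp only: power2_eq_square power3_eq_cube, algebra)
  have le: "(\<Sum>k<n. \<Sum>j<n. h k j y) \<le> indicator E y" if "y \<in> space ?P" for y
  proof -
    obtain k j where y4: "y 4 = (k, j)" by (cases "y 4")
    \<comment> \<open>Only the pair that \<open>y 4\<close> actually takes contributes, so the
      double sum collapses to one term, or to 0 if that pair is out of range.\<close>
    have hy: "h k' j' y = (if k' = k then if j' = j then h k j y else 0 else 0)" for k' j'
      by (simp add: h_def y4)
    have "(\<Sum>k'<n. \<Sum>j'<n. h k' j' y) =
        (\<Sum>k'<n. if k' = k then \<Sum>j'<n. if j' = j then h k j y else 0 else 0)"
      by (subst hy, intro sum.cong refl) simp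
    also have "\<dots> = (if k < n \<and> j < n then h k j y else 0)" by simp
    also have "\<dots> \<le> indicator E y"
      using win_weight_le[of j n k "y 1" "y 2" "y 3"] that
      by (auto simp: h_def y4 E_def indicator_def)
    finally show ?thesis .
  qed
  have "win_bound p n = (\<Sum>k<n. \<Sum>j<n. (\<integral>y. h k j y \<partial>?P))"
    unfolding win_bound_def by (intro sum.cong refl H [symmetric]) simp_all
  also have "\<dots> = (\<integral>y. (\<Sum>k<n. \<Sum>j<n. h k j y) \<partial>?P)"
    by (simp add: h del: One_nat_def)
  also have "\<dots> \<le> (\<integral>y. indicator E y \<partial>?P)"
    using h le by (intro integral_mono) (auto intro!: P.integrable_const_bound[of _ 1] simp del: One_nat_def)
  also have "\<dots> = P.prob E" by (simp del: One_nat_def)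
  finally show ?thesis unfolding E_def .
qed

section \<open>Closed form and limit of the bound\<close>

lemma sum_diff_squares: "(\<Sum>j<n. (real (n - j))\<^sup>2) = real n * (real n + 1) * (2 * real n + 1) / 6"
proof -
  have "(\<Sum>j<n. (real (n - j))\<^sup>2) = (\<Sum>j<n. (real (Suc j))\<^sup>2)"
    by (subst sum.nat_diff_reindex [symmetric]) (auto intro!: sum.cong)
  also have "\<dots> = real n * (real n + 1) * (2 * real n + 1) / 6"
    by (induction n) (auto simp: field_simps power2_eq_square)
  finally show ?thesis .
qed

text \<open>Every summand is homogeneous of degree four in \<open>p ^ k\<close>. The double sum
  therefore splits into a geometric sum of ratio \<open>p ^ 4\<close> and a sum over the index,
  which \<open>sum_diff_squares\<close> evaluates.\<close>

lemma win_bound_eq: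
  assumes "0 < p" "p < 1" "n > 0"
  shows "win_bound p n = (1 - p) * (1 - (p ^ 4) ^ n) / (1 - p ^ 4) *
     (1 - (1 - p) ^ 3 - 3 * (1 - p)\<^sup>2 * p * ((real n + 1) * (2 * real n + 1) / (6 * (real n)\<^sup>2)))"
proof -
  have "win_bound p n = (\<Sum>k<n. \<Sum>j<n. (p ^ 4) ^ k * ((1 - p) / n *
      (1 - (1 - p) ^ 3 - 3 * (1 - p)\<^sup>2 * p / (real n)\<^sup>2 * (real (n - j))\<^sup>2)))"
    unfolding win_bound_def
  proof (intro sum.cong refl)
    fix k j
    have "(p ^ 4) ^ k = (p ^ k) ^ 4" by (simp add: power_mult [symmetric] mult.commute)
    thus "((p ^ k) ^ 3 - ((1 - p) * p ^ k) ^ 3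
      - 3 * ((1 - p) * p ^ k * (real (n - j) / n))\<^sup>2 * p ^ Suc k) * ((1 - p) * p ^ k / n) =
      (p ^ 4) ^ k * ((1 - p) / n *
      (1 - (1 - p) ^ 3 - 3 * (1 - p)\<^sup>2 * p / (real n)\<^sup>2 * (real (n - j))\<^sup>2))"
      using assms by (simp only: power_Suc) (simp add: field_simps eval_nat_numeral)
  qed
  also have "\<dots> = (\<Sum>k<n. (p ^ 4) ^ k) * ((1 - p) / n *
      (n * (1 - (1 - p) ^ 3) - 3 * (1 - p)\<^sup>2 * p / (real n)\<^sup>2 * (\<Sum>j<n. (real (n - j))\<^sup>2)))"
    unfolding sum_distrib_left [symmetric] sum_distrib_right [symmetric] sum_subtractf
    by (simp add: right_diff_distrib)
  also have "(\<Sum>k<n. (p ^ 4) ^ k) = (1 - (p ^ 4) ^ n) / (1 - p ^ 4)"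
  proof -
    have "p ^ 4 < 1" using assms by (simp add: power_less_one_iff)
    thus ?thesis by (subst geometric_sum) (auto simp: field_simps)
  qed
  also have "\<dots> * ((1 - p) / n *
      (n * (1 - (1 - p) ^ 3) - 3 * (1 - p)\<^sup>2 * p / (real n)\<^sup>2 * (\<Sum>j<n. (real (n - j))\<^sup>2))) =
      (1 - p) * (1 - (p ^ 4) ^ n) / (1 - p ^ 4) *
     (1 - (1 - p) ^ 3 - 3 * (1 - p)\<^sup>2 * p * ((real n + 1) * (2 * real n + 1) / (6 * (real n)\<^sup>2)))"
  proof -
    have "(1 - p) / n *
      (n * (1 - (1 - p) ^ 3) - 3 * (1 - p)\<^sup>2 * p / (real n)\<^sup>2 * (\<Sum>j<n. (real (n - j))\<^sup>2)) =
      (1 - p) * (1 - (1 - p) ^ 3 - 3 * (1 - p)\<^sup>2 * p * ((real n + 1) * (2 * real n + 1) / (6 * (real n)\<^sup>2)))"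
      unfolding sum_diff_squares right_diff_distrib using assms by (simp add: power2_eq_square)
    thus ?thesis by simp
  qed
  finally show ?thesis .
qed

lemma win_bound_tendsto:
  assumes "0 < p" "p < 1"
  shows "win_bound p \<longlonglongrightarrow> p * (2 - p) / (1 + p + p^2 + p^3)"
proof -
  have p4: "0 < p ^ 4" "p ^ 4 < 1" using assms by (simp_all add: power_less_one_iff)
  \<comment> \<open>This is the average of \<open>((n - j) / n)^2\<close> over \<open>j < n\<close>,
    a Riemann sum of the square function on [0,1]; hence the limit 1/3.\<close>
  define r where "r n = (real n + 1) * (2 * real n + 1) / (6 * (real n)\<^sup>2)" for n
  have "(\<lambda>n. (p ^ 4) ^ n) \<longlonglongrightarrow> 0" using p4 by (intro LIMSEQ_power_zero) simp
  moreover have "r \<longlonglongrightarrow> 1 / 3" unfolding r_def by real_asymp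
  ultimately have "(\<lambda>n. (1 - p) * (1 - (p ^ 4) ^ n) / (1 - p ^ 4) *
     (1 - (1 - p) ^ 3 - 3 * (1 - p)\<^sup>2 * p * r n))
     \<longlonglongrightarrow> (1 - p) * (1 - 0) / (1 - p ^ 4) * (1 - (1 - p) ^ 3 - 3 * (1 - p)\<^sup>2 * p * (1 / 3))"
    using p4 by (intro tendsto_intros) auto
  moreover have "eventually (\<lambda>n. (1 - p) * (1 - (p ^ 4) ^ n) / (1 - p ^ 4) *
     (1 - (1 - p) ^ 3 - 3 * (1 - p)\<^sup>2 * p * r n) = win_bound p n) sequentially"
    using eventually_gt_at_top[of 0] by eventually_elim (simp add: win_bound_eq[OF assms] r_def)
  ultimately have "win_bound p \<longlonglongrightarrow>
      (1 - p) * (1 - 0) / (1 - p ^ 4) * (1 - (1 - p) ^ 3 - 3 * (1 - p)\<^sup>2 * p * (1 / 3))"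
    by (rule Lim_transform_eventually)
  also have "(1 - p) * (1 - 0) / (1 - p ^ 4) * (1 - (1 - p) ^ 3 - 3 * (1 - p)\<^sup>2 * p * (1 / 3)) =
      p * (2 - p) / (1 + p + p^2 + p^3)"
  proof -
    have "1 - p ^ 4 = (1 - p) * (1 + p + p^2 + p^3)"
      by (simp add: algebra_simps power2_eq_square eval_nat_numeral)
    \<comment> \<open>The 1/3 cancels the 3, and
      \<open>(1 - p)^3 + (1 - p)^2 * p = (1 - p)^2\<close>.\<close>
    moreover have "1 - (1 - p) ^ 3 - 3 * (1 - p)\<^sup>2 * p * (1 / 3) = p * (2 - p)"
      by (simp add: algebra_simps power2_eq_square power3_eq_cube)
    ultimately show ?thesis using assms by simp
  qed
  finally show ?thesis .
qed

section \<open>Discreteness of the measure, and the choice of \<open>p\<close> and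
  \<open>n\<close>\<close>

lemma discrete_prob_distr_pmf:
  fixes q :: "'a pmf" and f :: "'a \<Rightarrow> real"
  shows "discrete_prob (distr (measure_pmf q) borel f)"
proof -
  let ?A = "f ` set_pmf q"
  have pos: "measure (distr (measure_pmf q) borel f) {f x} > 0" if "x \<in> set_pmf q" for x
  proof -
    have "0 < pmf q x" using that by (simp add: pmf_positive)
    also have "pmf q x = measure_pmf.prob q {x}" by (simp add: measure_pmf_single)
    \<comment> \<open>\<open>f\<close> may merge several points, which only adds mass to the
      fibre.\<close>
    also have "\<dots> \<le> measure_pmf.prob q (f -` {f x})" by (intro measure_pmf.finite_measure_mono) auto
    finally show ?thesis by (simp add: measure_distr)
  qed
  have A: "?A \<in> sets borel" by (rule sets.countable) auto
  have "measure (distr (measure_pmf q) borel f) ?A = measure_pmf.prob q (f -` ?A)"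
    using A by (simp add: measure_distr)
  also have "\<dots> = 1" by (intro measure_pmf.prob_eq_1[THEN iffD2]) (auto simp: AE_measure_pmf_iff)
  finally have "measure (distr (measure_pmf q) borel f) ?A = 1" .
  thus ?thesis
    unfolding discrete_prob_def using pos
    by (intro conjI exI[of _ ?A] measure_pmf.prob_space_distr) auto
qed

theorem proposition4p1:
  fixes \<epsilon> :: real
  assumes "\<epsilon> > 0"
  shows "\<exists>\<mu> :: real measure.
           discrete_prob \<mu> \<and> measure \<mu> {0<..<1} = 1 \<and>
           \<P>(X in (\<Pi>\<^sub>M i\<in>{1..4::nat}. \<mu>). X 1 + X 2 + X 3 < 2 * X 4)
             \<ge> (SUP p\<in>{0<..<1::real}. p * (2 - p) / (1 + p + p^2 + p^3)) - \<epsilon>"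
proof -
  define F :: "real \<Rightarrow> real" where "F = (\<lambda>p. p * (2 - p) / (1 + p + p^2 + p^3))"
  \<comment> \<open>A crude bound is enough: it makes the real supremum meaningful, so that it can
    be approximated from below.\<close>
  have F_le: "F p \<le> 2" if "p \<in> {0<..<1}" for p
  proof -
    have "p * (2 - p) \<le> 1 * 2" using that by (intro mult_mono) auto
    also have "\<dots> \<le> 2 * (1 + p + p^2 + p^3)" using that by simp
    finally show ?thesis using that unfolding F_def by (subst pos_divide_le_eq) (auto intro!: add_pos_pos)
  qed
  have "bdd_above (F ` {0<..<1})" using F_le by (intro bdd_aboveI2)
  hence "\<exists>p\<in>{0<..<1}. (SUP p\<in>{0<..<1}. F p) - \<epsilon> < F p"
    using assms by (subst less_cSUP_iff [symmetric]) auto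
  then obtain p where p: "0 < p" "p < 1" "(SUP p\<in>{0<..<1}. F p) - \<epsilon> < F p" by auto
  \<comment> \<open>The inequality for \<open>F p\<close> is strict, so it passes to
    \<open>win_bound p n\<close> for large \<open>n\<close>; a single \<open>n\<close> then fixes
    the measure.\<close>
  have "eventually (\<lambda>n. (SUP p\<in>{0<..<1}. F p) - \<epsilon> < win_bound p n) sequentially"
    using win_bound_tendsto[OF p(1,2)] p(3) unfolding F_def by (rule order_tendstoD)
  then obtain n where n: "(SUP p\<in>{0<..<1}. F p) - \<epsilon> < win_bound p n"
    by (meson eventually_happens sequentially_bot)
  define \<mu> where "\<mu> = distr (measure_pmf (atom_law p n)) borel (atom n)"
  have "measure \<mu> {0<..<1} = measure_pmf.prob (atom_law p n) (atom n -` {0<..<1})"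
    unfolding \<mu>_def by (simp add: measure_distr)
  also have "atom n -` {0<..<1} = UNIV" using atom_bounds by auto
  finally have supp: "measure \<mu> {0<..<1} = 1" by simp
  have "(SUP p\<in>{0<..<1}. F p) - \<epsilon> \<le> win_bound p n" using n by simp
  also have "\<dots> \<le> \<P>(y in (\<Pi>\<^sub>M i\<in>{1..4::nat}. measure_pmf (atom_law p n)).
           atom n (y 1) + atom n (y 2) + atom n (y 3) < 2 * atom n (y 4))"
    by (rule win_bound_le_prob[OF p(1,2)])
  also have "\<dots> = \<P>(X in (\<Pi>\<^sub>M i\<in>{1..4::nat}. \<mu>). X 1 + X 2 + X 3 < 2 * X 4)"
  proof -
    have "Measurable.pred (\<Pi>\<^sub>M i\<in>{1..4::nat}. borel) (\<lambda>X. X 1 + X 2 + X 3 < (2 * X 4 :: real))"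
      by measurable
    thus ?thesis
      unfolding \<mu>_def by (subst prob_PiM_distr) (simp_all add: compose_def)
  qed
  finally show ?thesis
    using discrete_prob_distr_pmf[of "atom_law p n" "atom n"] supp unfolding \<mu>_def F_def by blast
qed

end
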